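(* Let $(G(V_g,E_g),p(\cdot,\cdot))$ be a sampled graph whose bivariate distribution $p(\cdot,\cdot)$ has the same marginal distributions, i.e. $p_V(v)=p_W(v)$ for all $v\in V_g$. Construct the sampled graph $(G(V_g,E_g),\tilde p(\cdot,\cdot))$ with the symmetric bivariate distribution $$\tilde p(v,w)=\frac{p(v,w)+p(w,v)}{2}.$$ For a partition $\mathcal{P}=\{S_c,\ c=1,2,\dots,C\}$ of $V_g$, let $Q(\mathcal{P})$ (resp. $\tilde Q(\mathcal{P})$) be the modularity index of $\mathcal{P}$ for the sampled graph $(G(V_g,E_g),p(\cdot,\cdot))$ (resp. $(G(V_g,E_g),\tilde p(\cdot,\cdot))$). Then, for every partition $\mathcal{P}$ of $V_g$, $$\tilde Q(\mathcal{P})=Q(\mathcal{P}).$$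
   Context: A sampled graph $(G(V_g,E_g),p(\cdot,\cdot))$ consists of a finite (possibly directed) graph with vertex set $V_g=\{1,\dots,n\}$ and edge set $E_g$, together with a probability distribution $p$ on $V_g\times V_g$ (not necessarily symmetric), which is the joint law of a random ordered pair of nodes $(V,W)$: $\mathsf{P}(V=v,W=w)=p(v,w)$. Its marginals are $p_V(v)=\sum_{w}p(v,w)$ and $p_W(w)=\sum_{v}p(v,w)$. When $p_V=p_W$: for $S\subset V_g$, the centrality of $S$ is $C(S)=\mathsf{P}(V\in S)=\mathsf{P}(W\in S)$; for $S_1,S_2\subset V_g$, the relative centrality is $C(S_1|S_2)=\mathsf{P}(W\in S_1\mid V\in S_2)$; the community strength of $S$ is $Str(S)=C(S|S)-C(S)$. The modularity index of a partition $\mathcal{P}=\{S_c,\ c=1,\dots,C\}$ of $V_g$ (where $C$ without argument is the number of sets) is $$Q(\mathcal{P})=\sum_{c=1}^{C} C(S_c)\cdot Str(S_c),$$ where a term with $C(S_c)=0$ is read as $0$; equivalently $Q(\mathcal{P})=\sum_{c=1}^{C}\sum_{v\in S_c}\sum_{w\in S_c}\bigl(p(v,w)-p_V(v)p_W(w)\bigr)$. *)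

theory Defs
  imports "HOL-Probability.Probability" "Graph_Theory.Pair_Digraph"
begin

text \<open>
  Arcs are ordered pairs, so an undirected graph is one with a symmetric arc set. The law
  \<open>p\<close> is that of the pair \<open>(V, W)\<close>, hence \<open>V = fst\<close> and \<open>W = snd\<close> on the sample space
  \<open>nat \<times> nat\<close>, and \<open>pmf p (v, w)\<close> is \<open>p(v, w)\<close>.
\<close>

locale sampled_graph = pair_fin_digraph G
  for G :: "nat pair_pre_digraph" +
  fixes n :: nat and p :: "(nat \<times> nat) pmf"
  assumes verts_eq: "pverts G = {1..n}"
    and supported: "set_pmf p \<subseteq> pverts G \<times> pverts G"

definition marginal_V :: "nat pair_pre_digraph \<Rightarrow> (nat \<times> nat) pmf \<Rightarrow> nat \<Rightarrow> real" where
  "marginal_V G p v = (\<Sum>w\<in>pverts G. pmf p (v, w))"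

definition marginal_W :: "nat pair_pre_digraph \<Rightarrow> (nat \<times> nat) pmf \<Rightarrow> nat \<Rightarrow> real" where
  "marginal_W G p w = (\<Sum>v\<in>pverts G. pmf p (v, w))"

text \<open>
  The next notions are meant for equal marginals, so that \<open>V\<close> and \<open>W\<close> have the same law and
  either may be used to define the centrality.
\<close>

definition centrality :: "(nat \<times> nat) pmf \<Rightarrow> nat set \<Rightarrow> real" where
  "centrality p S = \<P>(x in measure_pmf p. fst x \<in> S)"

definition relative_centrality :: "(nat \<times> nat) pmf \<Rightarrow> nat set \<Rightarrow> nat set \<Rightarrow> real" where
  "relative_centrality p S1 S2 = \<P>(x in measure_pmf p. snd x \<in> S1 \<bar> fst x \<in> S2)"

definition community_strength :: "(nat \<times> nat) pmf \<Rightarrow> nat set \<Rightarrow> real" where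
  "community_strength p S = relative_centrality p S S - centrality p S"

text \<open>A block of centrality \<open>0\<close> contributes \<open>0\<close>, whatever its community strength.\<close>

definition modularity :: "(nat \<times> nat) pmf \<Rightarrow> nat set set \<Rightarrow> real" where
  "modularity p \<P> = (\<Sum>S\<in>\<P>. centrality p S * community_strength p S)"

definition symmetrized :: "(nat \<times> nat) pmf \<Rightarrow> (nat \<times> nat) pmf" where
  "symmetrized p = embed_pmf (\<lambda>(v, w). (pmf p (v, w) + pmf p (w, v)) / 2)"

text \<open>\<^const>\<open>embed_pmf\<close> is meaningful only for functions of total mass one, which is checked here.\<close>

lemma pmf_symmetrized: "pmf (symmetrized p) (v, w) = (pmf p (v, w) + pmf p (w, v)) / 2"
proof -
  define q where "q = bind_pmf (bernoulli_pmf (1/2)) (\<lambda>b. if b then p else map_pmf prod.swap p)"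
  have swap: "pmf (map_pmf prod.swap p) (v, w) = pmf p (w, v)" for v w
    using pmf_map_inj'[of prod.swap p "(w, v)"] by simp
  have "pmf q x = (\<lambda>(v, w). (pmf p (v, w) + pmf p (w, v)) / 2) x" for x
    by (cases x) (simp add: q_def pmf_bind swap field_simps)
  hence "(\<lambda>(v, w). (pmf p (v, w) + pmf p (w, v)) / 2) = pmf q"
    by (intro ext) simp
  hence "symmetrized p = q"
    unfolding symmetrized_def by (simp add: type_definition.Rep_inverse[OF td_pmf_embed_pmf])
  thus ?thesis
    by (simp add: q_def pmf_bind swap field_simps)
qed

lemma sampled_graph_symmetrized:
  assumes "sampled_graph G n p"
  shows "sampled_graph G n (symmetrized p)"
proof -
  interpret sampled_graph G n p by fact
  have "set_pmf (symmetrized p) \<subseteq> pverts G \<times> pverts G"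
  proof (rule subrelI)
    fix v w assume "(v, w) \<in> set_pmf (symmetrized p)"
    hence "pmf p (v, w) \<noteq> 0 \<or> pmf p (w, v) \<noteq> 0"
      by (auto simp: set_pmf_iff pmf_symmetrized)
    thus "(v, w) \<in> pverts G \<times> pverts G"
      using supported by (auto simp: set_pmf_iff[symmetric])
  qed
  thus ?thesis
    by unfold_locales (use verts_eq in auto)
qed

lemma marginals_symmetrized: "marginal_V G (symmetrized p) v = marginal_W G (symmetrized p) v"
  by (simp add: marginal_V_def marginal_W_def pmf_symmetrized add.commute)

end

theory Submission
  imports Defs
begin

text \<open>
  A block contributes \<open>P(V \<in> S, W \<in> S) - C(S)\<^sup>2\<close> to the modularity. The first term is
  a sum of \<open>p\<close> over the square \<open>S \<times> S\<close>, which is invariant under transposition, and the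
  second is unchanged because symmetrizing replaces both marginals by their average.
\<close>

lemma centrality_times_strength:
  "centrality p S * community_strength p S = measure_pmf.prob p (S \<times> S) - (centrality p S)\<^sup>2"
proof -
  have sq: "{x. snd x \<in> S \<and> fst x \<in> S} = S \<times> S"
    by auto
  \<comment> \<open>The factor \<open>centrality p S\<close> cancels the denominator of the
    conditional probability only if it is nonzero. If it is zero, the left side is zero, and
    monotonicity makes \<open>S \<times> S\<close> a null set too.\<close>
  have "measure_pmf.prob p (S \<times> S) \<le> measure_pmf.prob p {x. fst x \<in> S}"
    by (intro measure_pmf.finite_measure_mono) auto
  hence "measure_pmf.prob p (S \<times> S) = 0" if "measure_pmf.prob p {x. fst x \<in> S} = 0"
    using that measure_nonneg[of p "S \<times> S"] by simp
  thus ?thesis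
    by (auto simp: community_strength_def relative_centrality_def cond_prob_def centrality_def
        sq right_diff_distrib power2_eq_square)
qed

lemma prob_square_symmetrized:
  assumes "finite S"
  shows "measure_pmf.prob (symmetrized p) (S \<times> S) = measure_pmf.prob p (S \<times> S)"
proof -
  have prob: "measure_pmf.prob q (S \<times> S) = (\<Sum>v\<in>S. \<Sum>w\<in>S. pmf q (v, w))" for q
    using assms by (simp add: measure_measure_pmf_finite sum.cartesian_product)
  \<comment> \<open>Both indices range over the same set, so the transposed half of
    \<open>symmetrized p\<close> has the same mass on the square.\<close>
  have "(\<Sum>v\<in>S. \<Sum>w\<in>S. pmf p (w, v)) = (\<Sum>v\<in>S. \<Sum>w\<in>S. pmf p (v, w))"
    by (rule sum.swap)
  thus ?thesis
    by (simp add: prob pmf_symmetrized sum.distrib flip: sum_divide_distrib)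
qed

text \<open>Since \<open>supported\<close> puts \<open>W\<close> in \<open>pverts G\<close> almost
  surely, the event that \<open>V\<close> lies in \<open>S\<close> is a finite rectangle up to a
  null set. This makes the pointwise hypothesis on marginals applicable to centralities.\<close>

lemma centrality_eq_sum_marginal:
  assumes "sampled_graph G n p" "S \<subseteq> pverts G"
  shows "centrality p S = (\<Sum>v\<in>S. marginal_V G p v)"
proof -
  interpret sampled_graph G n p by fact
  have fin: "finite (pverts G)" "finite S"
    using assms(2) verts_eq finite_subset by auto
  have "centrality p S = measure_pmf.prob p (S \<times> pverts G)"
    unfolding centrality_def using supported
    by (intro measure_pmf.finite_measure_eq_AE) (auto simp: AE_measure_pmf_iff)
  also have "\<dots> = (\<Sum>v\<in>S. marginal_V G p v)"
    using fin by (simp add: measure_measure_pmf_finite sum.cartesian_product marginal_V_def)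
  finally show ?thesis .
qed

lemma marginal_V_symmetrized:
  "marginal_V G (symmetrized p) v = (marginal_V G p v + marginal_W G p v) / 2"
  by (simp add: marginal_V_def marginal_W_def pmf_symmetrized sum.distrib flip: sum_divide_distrib)

theorem lemma9:
  fixes G :: "nat pair_pre_digraph" and n :: nat and p :: "(nat \<times> nat) pmf"
    and \<P> :: "nat set set"
  assumes "sampled_graph G n p"
    and "\<forall>v\<in>pverts G. marginal_V G p v = marginal_W G p v"
    and "partition_on (pverts G) \<P>"
  shows "modularity (symmetrized p) \<P> = modularity p \<P>"
  unfolding modularity_def
proof (rule sum.cong)
  fix S assume "S \<in> \<P>"
  hence S: "S \<subseteq> pverts G"
    using assms(3) by (auto simp: partition_on_def)
  interpret sampled_graph G n p by fact
  have "finite S"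
    using S verts_eq finite_subset by auto
  moreover have "centrality (symmetrized p) S = centrality p S"
    unfolding centrality_eq_sum_marginal[OF assms(1) S]
      centrality_eq_sum_marginal[OF sampled_graph_symmetrized[OF assms(1)] S]
    \<comment> \<open>Equality of the marginals enters here: their average is then
      \<open>marginal_V G p\<close> itself.\<close>
    using S assms(2) by (intro sum.cong) (auto simp: marginal_V_symmetrized)
  ultimately show "centrality (symmetrized p) S * community_strength (symmetrized p) S
      = centrality p S * community_strength p S"
    unfolding centrality_times_strength by (simp add: prob_square_symmetrized)
qed simp

end
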